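(* The solution of the totally discretized diffusion equation $$\frac{d\psi_{k,l}^r}{dt}=\frac12 D(\psi_{k,l}^r),\qquad D(\psi_{k,l}^r)=\bigl(\cos(e_r)D_x+\sin(e_r)D_y\bigr)^2(\psi_{k,l}^r)+\beta_N\bigl(\psi_{k,l}^{r-1}-2\psi_{k,l}^r+\psi_{k,l}^{r+1}\bigr),$$ $r=1,\dots,N$, $k,l=1,\dots,M$, with given initial condition, can be computed exactly by solving in parallel $M^2$ linear differential equations in dimension $N$.
   Context: $M,N$ are positive integers, $\beta_N>0$ is a parameter, and $e_r=\frac{2\pi r}{N}$. The unknown is an $M^2\times N$ table $\psi(t)=(\psi_{k,l}^r(t))\in\mathbb{C}^{N}\otimes\mathbb{C}^{M^2}\simeq\mathbb{C}^{N\cdot M^2}$, $r=1,\dots,N$, $k,l=1,\dots,M$, where, by periodicity, the upper index is taken modulo $N$ and the lower indices are taken modulo $M$. It approximates a function of $(x,y)$ and the discrete angle $e_r$ at the mesh points $x_k=\frac{k-1}{\sqrt M}$, $y_l=\frac{l-1}{\sqrt M}$, periodic in space. The discrete operators replacing $\frac{\partial}{\partial x}$ and $\frac{\partial}{\partial y}$, acting on $\mathbb{C}^{M^2}$ for each $r$, are $$D_x(\psi_{k,l}^r)=\frac{\sqrt M}{2}\bigl(\psi_{k+1,l}^r-\psi_{k-1,l}^r\bigr),\qquad D_y(\psi_{k,l}^r)=\frac{\sqrt M}{2}\bigl(\psi_{k,l+1}^r-\psi_{k,l-1}^r\bigr).$$ In the application to image reconstruction, the initial condition is the discrete analog of the function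 of $(x,y,\theta)$ obtained by lifting a planar image $f(x,y)$. *)

theory Defs
  imports Complex_Main
begin

text \<open>Tables \<open>\<psi> r k l\<close> have the angular index \<open>r\<close> first. Indices taken modulo \<open>N\<close> and
  modulo \<open>M\<close> are encoded by integer-indexed families periodic in each index, so such a table is
  determined by its entries with \<open>1 \<le> r \<le> N\<close> and \<open>1 \<le> k, l \<le> M\<close>.\<close>

type_synonym spatial_table = "int \<Rightarrow> int \<Rightarrow> complex"
type_synonym table = "int \<Rightarrow> spatial_table"

definition periodic_tables :: "nat \<Rightarrow> nat \<Rightarrow> table set" where
  "periodic_tables M N = {\<phi>. \<forall>r k l.
     \<phi> (r + int N) k l = \<phi> r k l \<and>
     \<phi> r (k + int M) l = \<phi> r k l \<and>
     \<phi> r k (l + int M) = \<phi> r k l}"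

definition angle :: "nat \<Rightarrow> int \<Rightarrow> real" where
  "angle N r = 2 * pi * of_int r / of_nat N"

definition D_x :: "nat \<Rightarrow> spatial_table \<Rightarrow> spatial_table" where
  "D_x M \<phi> k l = of_real (sqrt (of_nat M) / 2) * (\<phi> (k + 1) l - \<phi> (k - 1) l)"

definition D_y :: "nat \<Rightarrow> spatial_table \<Rightarrow> spatial_table" where
  "D_y M \<phi> k l = of_real (sqrt (of_nat M) / 2) * (\<phi> k (l + 1) - \<phi> k (l - 1))"

definition directional_D :: "nat \<Rightarrow> nat \<Rightarrow> int \<Rightarrow> spatial_table \<Rightarrow> spatial_table" where
  "directional_D M N r \<phi> k l =
     of_real (cos (angle N r)) * D_x M \<phi> k l + of_real (sin (angle N r)) * D_y M \<phi> k l"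

text \<open>The square of the directional operator is its composition with itself.\<close>

definition diffusion_D :: "nat \<Rightarrow> nat \<Rightarrow> real \<Rightarrow> table \<Rightarrow> table" where
  "diffusion_D M N \<beta> \<phi> r k l =
     (directional_D M N r ^^ 2) (\<phi> r) k l
     + of_real \<beta> * (\<phi> (r - 1) k l - 2 * \<phi> r k l + \<phi> (r + 1) k l)"

text \<open>Solutions live on \<open>t \<ge> 0\<close>; the derivative at \<open>t = 0\<close> is one-sided.\<close>

definition solves_diffusion ::
    "nat \<Rightarrow> nat \<Rightarrow> real \<Rightarrow> table \<Rightarrow> (real \<Rightarrow> table) \<Rightarrow> bool" where
  "solves_diffusion M N \<beta> \<psi>0 \<psi> \<longleftrightarrow>
     (\<forall>t\<ge>0. \<psi> t \<in> periodic_tables M N) \<and>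
     \<psi> 0 = \<psi>0 \<and>
     (\<forall>t\<ge>0. \<forall>r\<in>{1..int N}. \<forall>k\<in>{1..int M}. \<forall>l\<in>{1..int M}.
        ((\<lambda>s. \<psi> s r k l) has_vector_derivative
           1 / 2 * diffusion_D M N \<beta> (\<psi> t) r k l) (at t within {0..}))"

text \<open>The initial value problem \<open>u' = A u\<close>, \<open>u(0) = v\<close> in dimension \<open>N\<close>: vectors and matrices
  are indexed by \<open>{1..N}\<close>, and their values at other indices are irrelevant.\<close>

definition solves_linear_ivp ::
    "nat \<Rightarrow> (int \<Rightarrow> int \<Rightarrow> complex) \<Rightarrow> (int \<Rightarrow> complex) \<Rightarrow> (real \<Rightarrow> int \<Rightarrow> complex) \<Rightarrow> bool" where
  "solves_linear_ivp N A v u \<longleftrightarrow>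
     (\<forall>r\<in>{1..int N}. u 0 r = v r) \<and>
     (\<forall>t\<ge>0. \<forall>r\<in>{1..int N}.
        ((\<lambda>s. u s r) has_vector_derivative (\<Sum>s\<in>{1..int N}. A r s * u t s)) (at t within {0..}))"

text \<open>\<open>F\<close> and \<open>G\<close> are \<open>M\<^sup>2 \<times> M\<^sup>2\<close> matrices between the spatial index pairs \<open>(k, l)\<close> and the numbers
  \<open>j < M\<^sup>2\<close> of the equations; both act on each angular layer \<open>r\<close> in the same way.\<close>

definition encode ::
    "nat \<Rightarrow> (nat \<Rightarrow> int \<Rightarrow> int \<Rightarrow> complex) \<Rightarrow> table \<Rightarrow> nat \<Rightarrow> int \<Rightarrow> complex" where
  "encode M F \<phi> j r = (\<Sum>k\<in>{1..int M}. \<Sum>l\<in>{1..int M}. F j k l * \<phi> r k l)"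

definition decode ::
    "nat \<Rightarrow> (int \<Rightarrow> int \<Rightarrow> nat \<Rightarrow> complex) \<Rightarrow> (nat \<Rightarrow> int \<Rightarrow> complex) \<Rightarrow> table" where
  "decode M G v r k l = (\<Sum>j<M^2. G k l j * v j r)"

end

theory Submission
  imports Defs "HOL-Analysis.Derivative"
begin

text \<open>The two spatial differences \<open>D_x\<close> and \<open>D_y\<close> commute with translations of the spatial torus
  \<open>(\<int>/M)\<^sup>2\<close>, and so do all the operators \<open>cos e\<^sub>r D_x + sin e\<^sub>r D_y\<close>. They are
  therefore diagonal in one and the same basis, that of the \<open>M\<^sup>2\<close> characters
  \<open>(k, l) \<mapsto> exp (2\<pi>\<i> (p k + q l) / M)\<close>. On the angular layer \<open>r\<close> the character
  \<open>(p, q)\<close> has the eigenvalue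
  \<open>\<i> \<surd>M (cos e\<^sub>r sin (2\<pi>p/M) + sin e\<^sub>r sin (2\<pi>q/M))\<close>, which depends on \<open>r\<close>, while the
  characters themselves do not. The angular part of the diffusion couples the layers but acts in the
  same way at every mesh point. Hence a Fourier transform on each layer leaves, for each of the
  \<open>M\<^sup>2\<close> characters separately, a linear system for its \<open>N\<close> coefficients, one per layer: the
  squared eigenvalues on the diagonal plus \<open>\<beta>\<close> times the cyclic second difference, all times
  one half. This is \<open>diffusion_decode\<close>.

  The transform \<open>encode\<close> and its inverse \<open>decode\<close> are mutually inverse by the two orthogonality
  relations of the characters (\<open>decode_encode\<close>, \<open>encode_decode\<close>), so solutions correspond to
  solutions in both directions (\<open>encode_solution\<close>, \<open>decode_solution\<close>). Combined with existence
  and uniqueness for linear systems with constant coefficients, one direction shows that the diffusion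
  equation is solvable, and the other that each of its solutions is assembled from the given solutions
  of the \<open>M\<^sup>2\<close> systems.\<close>

section \<open>Linear systems with constant coefficients\<close>

text \<open>The solution is the exponential series \<open>\<Sum>n. A\<^sup>n v t\<^sup>n / n!\<close>, taken entry by entry. It
  converges for every \<open>t\<close> and may be differentiated termwise, since the entries of \<open>A\<^sup>n v\<close> grow at
  most geometrically. It solves the system on the whole real line; the uniqueness proof below needs
  this, because it runs a solution backwards.\<close>

lemma linear_ode_solution_exists:
  fixes A :: "'i \<Rightarrow> 'i \<Rightarrow> complex" and v :: "'i \<Rightarrow> complex"
  assumes "finite I"
  obtains u :: "real \<Rightarrow> 'i \<Rightarrow> complex"
  where "\<And>r. u 0 r = v r"
    and "\<And>t r S. r \<in> I \<Longrightarrow>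
           ((\<lambda>s. u s r) has_vector_derivative (\<Sum>s\<in>I. A r s * u t s)) (at t within S)"
proof -
  define w where "w n = ((\<lambda>x r. \<Sum>s\<in>I. A r s * x s) ^^ n) v" for n :: nat
  have w_0: "w 0 = v" and w_Suc: "w (Suc n) r = (\<Sum>s\<in>I. A r s * w n s)" for n r
    by (simp_all add: w_def)
  \<comment> \<open>\<open>K\<close> dominates the operator norm of \<open>A\<close> with respect to the sum norm.\<close>
  define K where "K = (\<Sum>r\<in>I. \<Sum>s\<in>I. cmod (A r s))"
  define C where "C = (\<Sum>s\<in>I. cmod (v s))"
  have "K \<ge> 0"
    unfolding K_def by (intro sum_nonneg) auto
  have w_sum: "(\<Sum>s\<in>I. cmod (w n s)) \<le> C * K ^ n" for n
  proof (induction n)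
    case 0
    show ?case by (simp add: w_0 C_def)
  next
    case (Suc n)
    have "(\<Sum>r\<in>I. cmod (w (Suc n) r)) \<le> (\<Sum>r\<in>I. \<Sum>s\<in>I. cmod (A r s) * cmod (w n s))"
      unfolding w_Suc by (intro sum_mono) (auto intro!: sum_norm_le simp: norm_mult)
    also have "\<dots> \<le> (\<Sum>r\<in>I. \<Sum>s\<in>I. cmod (A r s) * (\<Sum>s\<in>I. cmod (w n s)))"
      by (intro sum_mono mult_left_mono member_le_sum) (use assms in auto)
    also have "\<dots> = K * (\<Sum>s\<in>I. cmod (w n s))"
      by (simp add: K_def sum_distrib_right)
    also have "\<dots> \<le> K * (C * K ^ n)"
      using Suc \<open>K \<ge> 0\<close> by (rule mult_left_mono)
    finally show ?case by (simp add: mult_ac)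
  qed
  have summable_w: "summable (\<lambda>n. w n r / fact n * z ^ n)" if "r \<in> I" for r z
  proof (rule summable_comparison_test'[where N = 0])
    show "summable (\<lambda>n. C * ((K * cmod z) ^ n /\<^sub>R fact n))"
      by (intro summable_mult summable_exp_generic)
    fix n :: nat
    have "cmod (w n r) \<le> C * K ^ n"
      using member_le_sum[OF that, of "\<lambda>s. cmod (w n s)"] w_sum[of n] assms by force
    then have "cmod (w n r) * (cmod z ^ n / fact n) \<le> C * K ^ n * (cmod z ^ n / fact n)"
      by (rule mult_right_mono) simp
    then show "cmod (w n r / fact n * z ^ n) \<le> C * ((K * cmod z) ^ n /\<^sub>R fact n)"
      by (simp add: norm_mult norm_divide norm_power power_mult_distrib field_simps)
  qed
  have diffs_w: "diffs (\<lambda>n. w n r / fact n) = (\<lambda>n. w (Suc n) r / fact n)" for r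
    by (simp add: diffs_def fun_eq_iff field_simps del: of_nat_Suc)
  define u where "u t r = (\<Sum>n. w n r / fact n * of_real t ^ n)" for t :: real and r
  show ?thesis
  proof
    show "u 0 r = v r" for r
      using powser_zero[of "\<lambda>n. w n r / fact n"] by (simp add: u_def w_0)
    fix t :: real and r S assume "r \<in> I"
    have "(\<Sum>n. w (Suc n) r / fact n * of_real t ^ n)
        = (\<Sum>n. \<Sum>s\<in>I. A r s * (w n s / fact n * of_real t ^ n))"
      by (simp add: w_Suc sum_distrib_left sum_distrib_right sum_divide_distrib mult_ac)
    also have "\<dots> = (\<Sum>s\<in>I. \<Sum>n. A r s * (w n s / fact n * of_real t ^ n))"
      by (intro suminf_sum summable_mult summable_w)
    also have "\<dots> = (\<Sum>s\<in>I. A r s * u t s)"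
      unfolding u_def by (intro sum.cong refl suminf_mult summable_w)
    finally have "((\<lambda>z. \<Sum>n. w n r / fact n * z ^ n) has_field_derivative (\<Sum>s\<in>I. A r s * u t s))
        (at (of_real t))"
      using termdiffs_strong_converges_everywhere[OF summable_w[OF \<open>r \<in> I\<close>], of "of_real t"]
      unfolding diffs_w by simp
    then show "((\<lambda>s. u s r) has_vector_derivative (\<Sum>s\<in>I. A r s * u t s)) (at t within S)"
      unfolding u_def by (rule has_vector_derivative_real_field)
  qed
qed

text \<open>Uniqueness follows from existence by duality: a solution \<open>q\<close> of the transposed system, run
  backwards from time \<open>T\<close>, pairs with any solution \<open>w\<close> to a constant, and this constant
  is \<open>w T r\<close> at one end and a combination of the entries of \<open>w 0\<close> at the other.\<close>

lemma linear_ode_solution_unique: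
  fixes A :: "'i \<Rightarrow> 'i \<Rightarrow> complex" and w w' :: "real \<Rightarrow> 'i \<Rightarrow> complex"
  assumes "finite I"
    and w: "\<And>t r. t \<ge> 0 \<Longrightarrow> r \<in> I \<Longrightarrow>
          ((\<lambda>s. w s r) has_vector_derivative (\<Sum>s\<in>I. A r s * w t s)) (at t within {0..})"
    and w': "\<And>t r. t \<ge> 0 \<Longrightarrow> r \<in> I \<Longrightarrow>
          ((\<lambda>s. w' s r) has_vector_derivative (\<Sum>s\<in>I. A r s * w' t s)) (at t within {0..})"
    and init: "\<And>r. r \<in> I \<Longrightarrow> w 0 r = w' 0 r"
    and "T \<ge> 0" "r \<in> I"
  shows "w T r = w' T r"
proof -
  \<comment> \<open>Starting \<open>q\<close> at the unit vector of \<open>r\<close> makes the pairing at time \<open>T\<close> pick out the entry \<open>r\<close>.\<close>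
  obtain q :: "real \<Rightarrow> 'i \<Rightarrow> complex"
    where q_0: "\<And>s. q 0 s = (if s = r then 1 else 0)"
      and q: "\<And>t s S. s \<in> I \<Longrightarrow>
          ((\<lambda>t. q t s) has_vector_derivative (\<Sum>i\<in>I. A i s * q t i)) (at t within S)"
    using linear_ode_solution_exists[OF \<open>finite I\<close>, where A = "\<lambda>s i. A i s"
        and v = "\<lambda>s. if s = r then 1 else 0"] by blast
  have pairing: "y T r = (\<Sum>s\<in>I. q T s * y 0 s)"
    if y: "\<And>t r. t \<ge> 0 \<Longrightarrow> r \<in> I \<Longrightarrow>
          ((\<lambda>s. y s r) has_vector_derivative (\<Sum>s\<in>I. A r s * y t s)) (at t within {0..})" for y
  proof -
    define h where "h t = (\<Sum>s\<in>I. q (T - t) s * y t s)" for t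
    have "(h has_derivative (\<lambda>h. 0)) (at t within {0..})" if "t \<in> {0..}" for t
    proof -
      have rev: "((\<lambda>t. q (T - t) s) has_vector_derivative - (\<Sum>i\<in>I. A i s * q (T - t) i))
          (at t within {0..})" if "s \<in> I" for s
      proof -
        have "((\<lambda>t. T - t) has_vector_derivative -1) (at t within {0..})"
          by (auto intro!: derivative_eq_intros)
        from vector_diff_chain_within[OF this q[OF that]] show ?thesis
          by (simp add: o_def)
      qed
      have "(h has_vector_derivative
          (\<Sum>s\<in>I. q (T - t) s * (\<Sum>i\<in>I. A s i * y t i) + - (\<Sum>i\<in>I. A i s * q (T - t) i) * y t s))
          (at t within {0..})"
        unfolding h_def
        by (intro has_vector_derivative_sum has_vector_derivative_mult rev y) (use that in auto)
      moreover have "(\<Sum>s\<in>I. (\<Sum>i\<in>I. A i s * q (T - t) i) * y t s)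
          = (\<Sum>s\<in>I. q (T - t) s * (\<Sum>i\<in>I. A s i * y t i))"
        unfolding sum_distrib_left sum_distrib_right
        by (subst sum.swap) (simp add: mult_ac)
      ultimately have "(h has_vector_derivative 0) (at t within {0..})"
        by (simp add: sum_subtractf)
      then show ?thesis
        by (simp add: has_vector_derivative_def)
    qed
    from has_derivative_zero_constant[OF _ this] obtain c where "\<forall>t\<in>{0..}. h t = c"
      by auto
    then have "h T = h 0"
      using \<open>T \<ge> 0\<close> by simp
    moreover have "h T = (\<Sum>s\<in>I. if s = r then y T s else 0)"
      unfolding h_def by (intro sum.cong) (auto simp: q_0)
    ultimately show ?thesis
      using assms by (simp add: h_def)
  qed
  show ?thesis
    using pairing[of w] pairing[of w'] w w' init by simp
qed

corollary linear_ivp_solvable: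
  obtains u where "solves_linear_ivp N A v u"
proof -
  have "finite {1..int N}" by simp
  from linear_ode_solution_exists[OF this, where A = A and v = v] obtain u
    where "\<And>r. u 0 r = v r"
      and "\<And>t r S. r \<in> {1..int N} \<Longrightarrow>
           ((\<lambda>s. u s r) has_vector_derivative (\<Sum>s\<in>{1..int N}. A r s * u t s)) (at t within S)"
    by blast
  then have "solves_linear_ivp N A v u"
    by (simp add: solves_linear_ivp_def)
  then show ?thesis ..
qed

corollary linear_ivp_unique:
  assumes "solves_linear_ivp N A v u" "solves_linear_ivp N A v u'" "t \<ge> 0" "r \<in> {1..int N}"
  shows "u t r = u' t r"
  using assms unfolding solves_linear_ivp_def
  by (intro linear_ode_solution_unique[of "{1..int N}" u A u' t r]) auto

section \<open>Periodic sequences\<close>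

text \<open>The representative modulo \<open>M\<close> is taken in \<open>{1..M}\<close>, the index range of the tables, and not
  in \<open>{0..<M}\<close>.\<close>

definition residue :: "nat \<Rightarrow> int \<Rightarrow> int" where
  "residue M k = (k - 1) mod int M + 1"

lemma residue_in_range: "M > 0 \<Longrightarrow> residue M k \<in> {1..int M}"
  using pos_mod_bound[of "int M" "k - 1"] pos_mod_sign[of "int M" "k - 1"]
  unfolding residue_def atLeastAtMost_iff by linarith

lemma residue_id: "k \<in> {1..int M} \<Longrightarrow> residue M k = k"
  by (auto simp: residue_def)

lemma residue_shift: "residue M (k + int M) = residue M k"
  using mod_add_self2[of "k - 1" "int M"] by (simp add: residue_def algebra_simps)

lemma dvd_diff_iff_residue:
  assumes "s \<in> {1..int M}"
  shows "int M dvd s - k \<longleftrightarrow> s = residue M k"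
proof -
  have "int M dvd s - k \<longleftrightarrow> (s - 1) mod int M = (k - 1) mod int M"
    by (simp add: mod_eq_dvd_iff)
  also have "(s - 1) mod int M = s - 1"
    using assms by auto
  finally show ?thesis by (auto simp: residue_def)
qed

lemma periodic_residue:
  fixes f :: "int \<Rightarrow> 'a"
  assumes per: "\<And>k. f (k + int M) = f k"
  shows "f (residue M k) = f k"
proof -
  have up: "f (k + int n * int M) = f k" for n k
  proof (induction n)
    case (Suc n)
    then show ?case
      using per[of "k + int n * int M"] by (simp add: algebra_simps)
  qed simp
  have shift: "f (k + m * int M) = f k" for m k
    using up[of k "nat m"] up[of "k + m * int M" "nat (- m)"] by (cases "m \<ge> 0") simp_all
  have "residue M k = k + (- ((k - 1) div int M)) * int M"
    by (simp add: residue_def minus_div_mult_eq_mod[symmetric])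
  then show ?thesis by (simp only: shift)
qed

text \<open>A cyclic shift is thus an \<open>M \<times> M\<close> matrix: \<open>of_bool (int M dvd s - k)\<close> reads off the entry at
  \<open>k\<close> even if \<open>k\<close> lies outside \<open>{1..M}\<close>. This handles the wrap-around at the ends of the range,
  as well as \<open>M = 1\<close> and \<open>M = 2\<close>, where neighbours coincide.\<close>

lemma sum_delta_mod:
  fixes f :: "int \<Rightarrow> complex"
  assumes "M > 0" "\<And>k. f (k + int M) = f k"
  shows "(\<Sum>s\<in>{1..int M}. of_bool (int M dvd s - k) * f s) = f k"
proof -
  have "(\<Sum>s\<in>{1..int M}. of_bool (int M dvd s - k) * f s)
      = (\<Sum>s\<in>{1..int M}. if s = residue M k then f s else 0)"
    by (intro sum.cong) (auto simp: dvd_diff_iff_residue)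
  also have "\<dots> = f (residue M k)"
    using residue_in_range[OF \<open>M > 0\<close>, of k] by simp
  finally show ?thesis
    using periodic_residue[of f M k] assms by simp
qed

section \<open>The discrete Fourier transform\<close>

definition wave :: "nat \<Rightarrow> int \<Rightarrow> int \<Rightarrow> complex" where
  "wave M a k = cis (2 * pi * of_int (a * k) / of_nat M)"

lemma wave_commute: "wave M a k = wave M k a"
  by (simp add: wave_def mult.commute)

lemma wave_add: "wave M (a + b) k = wave M a k * wave M b k"
  by (simp add: wave_def cis_mult algebra_simps add_divide_distrib)

lemma wave_add_right: "wave M a (k + m) = wave M a k * wave M a m"
  by (simp add: wave_commute[of M a] wave_add)

lemma wave_eq_1_iff:
  assumes "M > 0"
  shows "wave M a 1 = 1 \<longleftrightarrow> int M dvd a"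
proof
  assume "wave M a 1 = 1"
  then have "cos (2 * pi * of_int a / of_nat M) = 1"
    by (simp add: wave_def complex_eq_iff)
  then obtain n :: int where "2 * pi * of_int a / of_nat M = of_int n * 2 * pi"
    using cos_one_2pi_int by blast
  then have "real_of_int a = of_int (n * int M)"
    using assms by (simp add: field_simps)
  then have "a = n * int M"
    by (simp only: of_int_eq_iff)
  then show "int M dvd a" by simp
next
  assume "int M dvd a"
  then obtain n where "a = int M * n" ..
  then have "2 * pi * real_of_int (a * 1) / real M = 2 * pi * of_int n"
    using assms by simp
  then show "wave M a 1 = 1"
    by (simp only: wave_def cis_multiple_2pi Ints_of_int)
qed

lemma wave_period: "M > 0 \<Longrightarrow> wave M a (k + int M) = wave M a k"
  using wave_eq_1_iff[of M "int M * a"]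
  by (simp add: wave_add_right) (simp add: wave_def mult.commute)

lemma wave_of_nat: "wave M a (int n) = wave M a 1 ^ n"
  by (simp add: wave_def DeMoivre mult_ac)

text \<open>Orthogonality of characters: the powers of an \<open>M\<close>-th root of unity other than \<open>1\<close> form a
  geometric sum with value \<open>0\<close>. Frequencies run over \<open>{..<M}\<close> and positions over \<open>{1..M}\<close>;
  the next two lemmas give the sum over either range.\<close>

lemma sum_wave_frequencies:
  assumes "M > 0"
  shows "(\<Sum>p<M. wave M a (int p)) = of_nat M * of_bool (int M dvd a)"
proof (cases "int M dvd a")
  case True
  then have "wave M a 1 = 1"
    using assms by (simp add: wave_eq_1_iff)
  then show ?thesis
    using True by (simp add: wave_of_nat)
next
  case False
  have "wave M a 1 ^ M = wave M a (0 + int M)"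
    by (simp add: wave_of_nat)
  also have "\<dots> = 1"
    unfolding wave_period[OF assms] by (simp add: wave_def)
  finally show ?thesis
    using False assms by (simp add: wave_of_nat sum_gp_strict wave_eq_1_iff)
qed

lemma sum_wave_positions:
  assumes "M > 0"
  shows "(\<Sum>k\<in>{1..int M}. wave M a k) = of_nat M * of_bool (int M dvd a)"
proof -
  have "(\<Sum>k\<in>{1..int M}. wave M a k) = (\<Sum>p<M. wave M a (int p + 1))"
    by (rule sum.reindex_bij_witness[where i = "\<lambda>p. int p + 1" and j = "\<lambda>k. nat (k - 1)"]) auto
  also have "\<dots> = wave M a 1 * (\<Sum>p<M. wave M a (int p))"
    by (simp add: wave_add_right sum_distrib_left mult_ac)
  finally show ?thesis
    using wave_eq_1_iff[OF assms, of a] by (simp add: sum_wave_frequencies[OF assms])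
qed


lemma wave_diff_frequency: "wave M (b - a) k = wave M b k * wave M (- a) k"
  using wave_add[of M b "- a" k] by simp

lemma wave_diff_position: "wave M (k - m) a = wave M a k * wave M (- a) m"
  by (simp add: wave_commute[of M a k] wave_diff_frequency) (simp add: wave_def mult.commute)

text \<open>Characters are eigenvectors of translations, hence of the central difference.\<close>

lemma wave_central_difference:
  "wave M a (k + 1) - wave M a (k - 1)
     = 2 * \<i> * of_real (sin (2 * pi * of_int a / of_nat M)) * wave M a k"
proof -
  have "wave M a 1 - wave M a (- 1) = 2 * \<i> * of_real (sin (2 * pi * of_int a / of_nat M))"
    by (simp add: wave_def complex_eq_iff)
  moreover have "wave M a (k + 1) - wave M a (k - 1) = (wave M a 1 - wave M a (- 1)) * wave M a k"
    unfolding diff_conv_add_uminus[of k] wave_add_right by (simp add: algebra_simps)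
  ultimately show ?thesis by simp
qed

section \<open>Fourier modes on the spatial torus\<close>

text \<open>The number \<open>j < M\<^sup>2\<close> stands for the pair of frequencies \<open>(j div M, j mod M)\<close>.
  The normalizing factor \<open>1 / M\<^sup>2\<close> of the transform is placed entirely in \<open>analysis\<close>.\<close>

definition synthesis :: "nat \<Rightarrow> int \<Rightarrow> int \<Rightarrow> nat \<Rightarrow> complex" where
  "synthesis M k l j = wave M (int (j div M)) k * wave M (int (j mod M)) l"

definition analysis :: "nat \<Rightarrow> nat \<Rightarrow> int \<Rightarrow> int \<Rightarrow> complex" where
  "analysis M j k l = wave M (- int (j div M)) k * wave M (- int (j mod M)) l / of_nat M ^ 2"

lemma sum_div_mod:
  fixes f :: "nat \<Rightarrow> nat \<Rightarrow> 'a::comm_monoid_add"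
  shows "(\<Sum>j<M^2. f (j div M) (j mod M)) = (\<Sum>p<M. \<Sum>q<M. f p q)"
proof -
  have bound: "p * M + q < M^2" if "p < M" "q < M" for p q
  proof -
    have "p * M + q < Suc p * M" using that by simp
    also have "\<dots> \<le> M * M" using that by (intro mult_le_mono1) simp
    finally show ?thesis by (simp add: power2_eq_square)
  qed
  have quotient: "j div M < M" if "j < M^2" for j
    using that by (simp add: power2_eq_square less_mult_imp_div_less)
  have "(\<Sum>j<M^2. f (j div M) (j mod M)) = (\<Sum>(p, q)\<in>{..<M} \<times> {..<M}. f p q)"
    by (rule sum.reindex_bij_witness[where i = "\<lambda>(p, q). p * M + q" and j = "\<lambda>j. (j div M, j mod M)"])
       (auto simp: bound quotient intro!: mod_less_divisor gr0I)
  then show ?thesis by (simp add: sum.cartesian_product)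
qed

text \<open>Both orthogonality relations factor into two one-dimensional ones. The first says that the
  \<open>M\<^sup>2\<close> characters are complete, the second that they are independent.\<close>

lemma synthesis_analysis:
  assumes "M > 0"
  shows "(\<Sum>j<M^2. synthesis M k l j * analysis M j k' l')
    = of_bool (int M dvd k' - k) * of_bool (int M dvd l' - l)"
proof -
  have "(\<Sum>j<M^2. synthesis M k l j * analysis M j k' l')
      = (\<Sum>p<M. \<Sum>q<M. wave M (k - k') (int p) * wave M (l - l') (int q) / of_nat M ^ 2)"
    unfolding synthesis_def analysis_def
    unfolding wave_diff_position
    by (subst sum_div_mod[symmetric]) (simp add: mult_ac)
  also have "\<dots> = (\<Sum>p<M. wave M (k - k') (int p)) * (\<Sum>q<M. wave M (l - l') (int q)) / of_nat M ^ 2"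
    by (simp add: sum_product sum_divide_distrib)
  finally show ?thesis
    using assms
    by (simp add: sum_wave_frequencies power2_eq_square dvd_diff_commute[of _ k] dvd_diff_commute[of _ l])
qed

lemma analysis_synthesis:
  assumes "M > 0" "j < M^2" "j' < M^2"
  shows "(\<Sum>k\<in>{1..int M}. \<Sum>l\<in>{1..int M}. analysis M j k l * synthesis M k l j') = of_bool (j' = j)"
proof -
  define p q p' q' where defs: "p = j div M" "q = j mod M" "p' = j' div M" "q' = j' mod M"
  have "(\<Sum>k\<in>{1..int M}. \<Sum>l\<in>{1..int M}. analysis M j k l * synthesis M k l j')
      = (\<Sum>k\<in>{1..int M}. \<Sum>l\<in>{1..int M}.
          wave M (int p' - int p) k * wave M (int q' - int q) l / of_nat M ^ 2)"
    unfolding synthesis_def analysis_def defs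
    unfolding wave_diff_frequency by (simp add: mult_ac)
  also have "\<dots> = (\<Sum>k\<in>{1..int M}. wave M (int p' - int p) k)
        * (\<Sum>l\<in>{1..int M}. wave M (int q' - int q) l) / of_nat M ^ 2"
    by (simp add: sum_product sum_divide_distrib)
  also have "\<dots> = of_bool (int M dvd int p' - int p \<and> int M dvd int q' - int q)"
    using assms by (simp add: sum_wave_positions power2_eq_square)
  also have "int M dvd int p' - int p \<and> int M dvd int q' - int q \<longleftrightarrow> p' = p \<and> q' = q"
  proof -
    have "p < M" "q < M" "p' < M" "q' < M"
      using assms by (auto simp: defs power2_eq_square less_mult_imp_div_less)
    then show ?thesis
      by (simp add: mod_eq_dvd_iff[symmetric])
  qed
  also have "\<dots> \<longleftrightarrow> j' = j"
    unfolding defs by (metis div_mult_mod_eq)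
  finally show ?thesis .
qed

lemma decode_encode:
  assumes "M > 0" "\<phi> \<in> periodic_tables M N"
  shows "decode M (synthesis M) (encode M (analysis M) \<phi>) = \<phi>"
proof (intro ext)
  fix r k l
  have per: "\<phi> r (k + int M) l = \<phi> r k l" "\<phi> r k (l + int M) = \<phi> r k l" for k l
    using assms by (auto simp: periodic_tables_def)
  have "decode M (synthesis M) (encode M (analysis M) \<phi>) r k l
      = (\<Sum>j<M^2. \<Sum>k'\<in>{1..int M}. \<Sum>l'\<in>{1..int M}.
           synthesis M k l j * analysis M j k' l' * \<phi> r k' l')"
    by (simp add: decode_def encode_def sum_distrib_left mult_ac)
  also have "\<dots> = (\<Sum>k'\<in>{1..int M}. \<Sum>l'\<in>{1..int M}.
           (\<Sum>j<M^2. synthesis M k l j * analysis M j k' l') * \<phi> r k' l')"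
    by (subst sum.swap, subst sum.swap) (simp add: sum_distrib_right)
  also have "\<dots> = (\<Sum>k'\<in>{1..int M}. of_bool (int M dvd k' - k) *
           (\<Sum>l'\<in>{1..int M}. of_bool (int M dvd l' - l) * \<phi> r k' l'))"
    unfolding synthesis_analysis[OF \<open>M > 0\<close>] sum_distrib_left by (simp only: mult.assoc)
  also have "\<dots> = \<phi> r k l"
    using sum_delta_mod[OF \<open>M > 0\<close>, of "\<phi> r _"]
      sum_delta_mod[OF \<open>M > 0\<close>, of "\<lambda>k. \<phi> r k l"] by (simp only: per)
  finally show "decode M (synthesis M) (encode M (analysis M) \<phi>) r k l = \<phi> r k l" .
qed

lemma encode_decode:
  assumes "M > 0" "j < M^2"
  shows "encode M (analysis M) (decode M (synthesis M) v) j r = v j r"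
proof -
  have "encode M (analysis M) (decode M (synthesis M) v) j r
      = (\<Sum>k\<in>{1..int M}. \<Sum>l\<in>{1..int M}. \<Sum>j'<M^2. analysis M j k l * synthesis M k l j' * v j' r)"
    by (simp add: decode_def encode_def sum_distrib_left mult_ac)
  also have "\<dots> = (\<Sum>j'<M^2. \<Sum>k\<in>{1..int M}. \<Sum>l\<in>{1..int M}.
        analysis M j k l * synthesis M k l j' * v j' r)"
    by (subst (2) sum.swap, subst sum.swap) simp
  also have "\<dots> = (\<Sum>j'<M^2. (\<Sum>k\<in>{1..int M}. \<Sum>l\<in>{1..int M}.
        analysis M j k l * synthesis M k l j') * v j' r)"
    by (simp add: sum_distrib_right)
  also have "\<dots> = (\<Sum>j'<M^2. if j' = j then v j' r else 0)"
    using assms by (intro sum.cong) (auto simp: analysis_synthesis)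
  also have "\<dots> = v j r"
    using assms by simp
  finally show ?thesis .
qed

lemma decode_periodic:
  assumes "M > 0" "\<And>j r. v j (r + int N) = v j r"
  shows "decode M (synthesis M) v \<in> periodic_tables M N"
  using assms by (simp add: periodic_tables_def decode_def synthesis_def wave_period)

lemma encode_periodic:
  assumes "\<phi> \<in> periodic_tables M N"
  shows "encode M F \<phi> j (r + int N) = encode M F \<phi> j r"
  using assms by (simp add: periodic_tables_def encode_def)

section \<open>The diffusion operator in Fourier coordinates\<close>

text \<open>The eigenvalue of the directional derivative of layer \<open>r\<close> on the \<open>j\<close>-th character.\<close>

definition symbol :: "nat \<Rightarrow> nat \<Rightarrow> nat \<Rightarrow> int \<Rightarrow> complex" where
  "symbol M N j r = \<i> * of_real (sqrt (of_nat M) *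
     (cos (angle N r) * sin (2 * pi * of_nat (j div M) / of_nat M)
      + sin (angle N r) * sin (2 * pi * of_nat (j mod M) / of_nat M)))"

text \<open>The three terms with divisibility conditions are the cyclic shift to \<open>r - 1\<close>, the
  identity, and the cyclic shift to \<open>r + 1\<close>, in the form of \<open>sum_delta_mod\<close>.\<close>

definition mode_matrix :: "nat \<Rightarrow> nat \<Rightarrow> real \<Rightarrow> nat \<Rightarrow> int \<Rightarrow> int \<Rightarrow> complex" where
  "mode_matrix M N \<beta> j r s =
     1 / 2 * (symbol M N j r ^ 2 * of_bool (int N dvd s - r)
       + of_real \<beta> * (of_bool (int N dvd s - (r - 1)) - 2 * of_bool (int N dvd s - r)
           + of_bool (int N dvd s - (r + 1))))"

lemma mode_matrix_apply:
  assumes "N > 0" "\<And>r. v (r + int N) = v r"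
  shows "(\<Sum>s\<in>{1..int N}. mode_matrix M N \<beta> j r s * v s)
    = 1 / 2 * (symbol M N j r ^ 2 * v r + of_real \<beta> * (v (r - 1) - 2 * v r + v (r + 1)))"
proof -
  have "(\<Sum>s\<in>{1..int N}. mode_matrix M N \<beta> j r s * v s)
    = 1 / 2 * (symbol M N j r ^ 2 * (\<Sum>s\<in>{1..int N}. of_bool (int N dvd s - r) * v s)
       + of_real \<beta> * ((\<Sum>s\<in>{1..int N}. of_bool (int N dvd s - (r - 1)) * v s)
           - 2 * (\<Sum>s\<in>{1..int N}. of_bool (int N dvd s - r) * v s)
           + (\<Sum>s\<in>{1..int N}. of_bool (int N dvd s - (r + 1)) * v s)))"
    unfolding sum_distrib_left sum_subtractf[symmetric] sum.distrib[symmetric]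
    by (intro sum.cong refl) (simp only: mode_matrix_def, simp only: algebra_simps)
  then show ?thesis
    by (simp only: sum_delta_mod[of N v, OF assms])
qed

lemma directional_D_synthesis:
  "directional_D M N r (\<lambda>k l. \<Sum>j<M^2. synthesis M k l j * c j)
     = (\<lambda>k l. \<Sum>j<M^2. synthesis M k l j * (symbol M N j r * c j))"
proof (intro ext)
  fix k l
  let ?f = "\<lambda>k l. \<Sum>j<M^2. synthesis M k l j * c j"
  let ?h = "of_real (sqrt (of_nat M) / 2) :: complex"
  have "D_x M ?f k l = (\<Sum>j<M^2. ?h * ((wave M (int (j div M)) (k + 1) - wave M (int (j div M)) (k - 1))
      * wave M (int (j mod M)) l * c j))"
    unfolding D_x_def sum_subtractf[symmetric] sum_distrib_left
    by (intro sum.cong refl) (simp add: synthesis_def algebra_simps)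
  then have x: "D_x M ?f k l = (\<Sum>j<M^2. synthesis M k l j *
      (\<i> * of_real (sqrt (of_nat M) * sin (2 * pi * of_nat (j div M) / of_nat M)) * c j))"
    unfolding wave_central_difference by (simp add: synthesis_def mult_ac)
  have "D_y M ?f k l = (\<Sum>j<M^2. ?h * ((wave M (int (j mod M)) (l + 1) - wave M (int (j mod M)) (l - 1))
      * wave M (int (j div M)) k * c j))"
    unfolding D_y_def sum_subtractf[symmetric] sum_distrib_left
    by (intro sum.cong refl) (simp add: synthesis_def algebra_simps)
  then have y: "D_y M ?f k l = (\<Sum>j<M^2. synthesis M k l j *
      (\<i> * of_real (sqrt (of_nat M) * sin (2 * pi * of_nat (j mod M) / of_nat M)) * c j))"
    unfolding wave_central_difference by (simp add: synthesis_def mult_ac)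
  show "directional_D M N r ?f k l = (\<Sum>j<M^2. synthesis M k l j * (symbol M N j r * c j))"
    unfolding directional_D_def x y sum_distrib_left sum.distrib[symmetric]
    by (intro sum.cong refl) (simp add: symbol_def algebra_simps)
qed

text \<open>The decoupling: in Fourier coordinates the diffusion operator is block diagonal, with one
  \<open>N \<times> N\<close> block for each character. Since all layers share the same characters, the angular
  coupling never mixes different \<open>j\<close>.\<close>

lemma diffusion_decode:
  assumes "N > 0" "\<And>j r. j < M^2 \<Longrightarrow> v j (r + int N) = v j r"
  shows "1 / 2 * diffusion_D M N \<beta> (decode M (synthesis M) v) r k l
    = decode M (synthesis M) (\<lambda>j r. \<Sum>s\<in>{1..int N}. mode_matrix M N \<beta> j r s * v j s) r k l"
proof -
  have layer: "decode M (synthesis M) v r = (\<lambda>k l. \<Sum>j<M^2. synthesis M k l j * v j r)"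
    by (intro ext) (simp add: decode_def)
  have square: "(g ^^ 2) x = g (g x)" for g :: "spatial_table \<Rightarrow> spatial_table" and x
    by (simp add: numeral_2_eq_2)
  have "(directional_D M N r ^^ 2) (decode M (synthesis M) v r) k l
      = (\<Sum>j<M^2. synthesis M k l j * (symbol M N j r * (symbol M N j r * v j r)))"
    unfolding layer square by (simp only: directional_D_synthesis)
  then have "1 / 2 * diffusion_D M N \<beta> (decode M (synthesis M) v) r k l
      = (\<Sum>j<M^2. synthesis M k l j * (1 / 2 * (symbol M N j r ^ 2 * v j r
           + of_real \<beta> * (v j (r - 1) - 2 * v j r + v j (r + 1)))))"
    unfolding diffusion_D_def decode_def
    by (simp add: sum_distrib_left sum_subtractf sum.distrib algebra_simps power2_eq_square)
  also have "\<dots> = decode M (synthesis M)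
      (\<lambda>j r. \<Sum>s\<in>{1..int N}. mode_matrix M N \<beta> j r s * v j s) r k l"
    unfolding decode_def
    by (intro sum.cong refl arg_cong2[where f = "(*)"] mode_matrix_apply[symmetric])
       (use assms in auto)
  finally show ?thesis .
qed

text \<open>The derivative can be taken under the finite sum of \<open>encode\<close>. Writing the table \<open>\<psi> t\<close> itself as
  \<open>decode\<close> of its coefficients then turns the diffusion operator into the blocks, by
  \<open>diffusion_decode\<close>, and \<open>encode\<close> cancels the remaining \<open>decode\<close>.\<close>

lemma encode_solution:
  assumes "M > 0" "N > 0" "solves_diffusion M N \<beta> \<psi>0 \<psi>" "j < M^2"
  shows "solves_linear_ivp N (mode_matrix M N \<beta> j) (encode M (analysis M) \<psi>0 j)
    (\<lambda>t. encode M (analysis M) (\<psi> t) j)"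
proof -
  let ?v = "\<lambda>t. encode M (analysis M) (\<psi> t)"
  have "((\<lambda>s. ?v s j r) has_vector_derivative
      (\<Sum>s\<in>{1..int N}. mode_matrix M N \<beta> j r s * ?v t j s)) (at t within {0..})"
    if "t \<ge> 0" "r \<in> {1..int N}" for t r
  proof -
    have per: "\<psi> t \<in> periodic_tables M N"
      using assms \<open>t \<ge> 0\<close> by (simp add: solves_diffusion_def)
    have rhs: "1 / 2 * diffusion_D M N \<beta> (\<psi> t) r k l = decode M (synthesis M)
        (\<lambda>j r. \<Sum>s\<in>{1..int N}. mode_matrix M N \<beta> j r s * ?v t j s) r k l" for k l
      using diffusion_decode[OF \<open>N > 0\<close>, of M "?v t" \<beta> r k l]
      by (simp only: encode_periodic[OF per] decode_encode[OF \<open>M > 0\<close> per])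
    have "((\<lambda>s. ?v s j r) has_vector_derivative
        (\<Sum>k\<in>{1..int M}. \<Sum>l\<in>{1..int M}.
           analysis M j k l * (1 / 2 * diffusion_D M N \<beta> (\<psi> t) r k l))) (at t within {0..})"
      unfolding encode_def using assms that
      by (intro has_vector_derivative_sum has_vector_derivative_mult_right)
         (simp add: solves_diffusion_def)
    also have "(\<Sum>k\<in>{1..int M}. \<Sum>l\<in>{1..int M}.
           analysis M j k l * (1 / 2 * diffusion_D M N \<beta> (\<psi> t) r k l))
        = encode M (analysis M) (decode M (synthesis M)
            (\<lambda>j r. \<Sum>s\<in>{1..int N}. mode_matrix M N \<beta> j r s * ?v t j s)) j r"
      unfolding rhs encode_def[of M "analysis M" "decode _ _ _"] ..
    also have "\<dots> = (\<Sum>s\<in>{1..int N}. mode_matrix M N \<beta> j r s * ?v t j s)"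
      by (rule encode_decode[OF assms(1,4)])
    finally show ?thesis .
  qed
  moreover have "\<psi> 0 = \<psi>0"
    using assms by (simp add: solves_diffusion_def)
  ultimately show ?thesis
    by (simp add: solves_linear_ivp_def)
qed

text \<open>The functions \<open>u j t\<close> are only meaningful on \<open>{1..N}\<close>, whereas a table is indexed by all
  integers; composing with \<open>residue N\<close> extends them periodically.\<close>

lemma decode_solution:
  assumes "M > 0" "N > 0" "\<psi>0 \<in> periodic_tables M N"
    and u: "\<And>j. j < M^2 \<Longrightarrow>
      solves_linear_ivp N (mode_matrix M N \<beta> j) (encode M (analysis M) \<psi>0 j) (u j)"
  shows "solves_diffusion M N \<beta> \<psi>0 (\<lambda>t. decode M (synthesis M) (\<lambda>j r. u j t (residue N r)))"
proof -
  let ?v = "\<lambda>t j r. u j t (residue N r)"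
  have per: "?v t j (r + int N) = ?v t j r" for t j r
    by (simp add: residue_shift)
  have "?v 0 j r = encode M (analysis M) \<psi>0 j r" if "j < M^2" for j r
  proof -
    have "?v 0 j r = encode M (analysis M) \<psi>0 j (residue N r)"
      using u[OF that] residue_in_range[OF \<open>N > 0\<close>] by (simp add: solves_linear_ivp_def)
    then show ?thesis
      by (simp add: periodic_residue encode_periodic[OF assms(3)])
  qed
  then have "decode M (synthesis M) (?v 0) = decode M (synthesis M) (encode M (analysis M) \<psi>0)"
    by (simp add: decode_def fun_eq_iff)
  then have init: "decode M (synthesis M) (?v 0) = \<psi>0"
    by (simp add: decode_encode[OF assms(1,3)])
  have "((\<lambda>s. decode M (synthesis M) (?v s) r k l) has_vector_derivative
      1 / 2 * diffusion_D M N \<beta> (decode M (synthesis M) (?v t)) r k l) (at t within {0..})"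
    if "t \<ge> 0" "r \<in> {1..int N}" for t r k l
  proof -
    have "((\<lambda>s. decode M (synthesis M) (?v s) r k l) has_vector_derivative
        decode M (synthesis M) (\<lambda>j r. \<Sum>s\<in>{1..int N}. mode_matrix M N \<beta> j r s * ?v t j s) r k l)
        (at t within {0..})"
      unfolding decode_def
    proof (intro has_vector_derivative_sum has_vector_derivative_mult_right)
      fix j assume "j \<in> {..<M^2}"
      then have "((\<lambda>s. u j s r) has_vector_derivative
          (\<Sum>s\<in>{1..int N}. mode_matrix M N \<beta> j r s * u j t s)) (at t within {0..})"
        using u[of j] that by (simp add: solves_linear_ivp_def)
      then show "((\<lambda>s. ?v s j r) has_vector_derivative
          (\<Sum>s\<in>{1..int N}. mode_matrix M N \<beta> j r s * ?v t j s)) (at t within {0..})"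
        using that by (simp add: residue_id)
    qed
    then show ?thesis
      by (subst diffusion_decode[OF \<open>N > 0\<close>, of M "?v t"]) (rule per)
  qed
  then show ?thesis
    by (simp add: solves_diffusion_def init decode_periodic[OF \<open>M > 0\<close>, where v = "?v _"] per)
qed

section \<open>Parallel solution of the diffusion equation\<close>

theorem theorem3:
  fixes M N :: nat and \<beta> :: real
  assumes "M > 0" and "N > 0" and "\<beta> > 0"
  shows "\<exists>(F :: nat \<Rightarrow> int \<Rightarrow> int \<Rightarrow> complex)
          (G :: int \<Rightarrow> int \<Rightarrow> nat \<Rightarrow> complex)
          (A :: nat \<Rightarrow> int \<Rightarrow> int \<Rightarrow> complex).
     \<forall>\<psi>0 \<in> periodic_tables M N.
       (\<exists>\<psi>. solves_diffusion M N \<beta> \<psi>0 \<psi>) \<and>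
       (\<forall>j<M^2. \<exists>u. solves_linear_ivp N (A j) (encode M F \<psi>0 j) u) \<and>
       (\<forall>\<psi> u. solves_diffusion M N \<beta> \<psi>0 \<psi> \<longrightarrow>
          (\<forall>j<M^2. solves_linear_ivp N (A j) (encode M F \<psi>0 j) (u j)) \<longrightarrow>
          (\<forall>t\<ge>0. \<forall>r\<in>{1..int N}. \<forall>k\<in>{1..int M}. \<forall>l\<in>{1..int M}.
             \<psi> t r k l = decode M G (\<lambda>j. u j t) r k l))"
proof (rule exI[of _ "analysis M"], rule exI[of _ "synthesis M"],
    rule exI[of _ "mode_matrix M N \<beta>"], intro ballI conjI allI impI)
  fix \<psi>0 assume \<psi>0: "\<psi>0 \<in> periodic_tables M N"
  let ?ivp = "\<lambda>j. solves_linear_ivp N (mode_matrix M N \<beta> j) (encode M (analysis M) \<psi>0 j)"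
  show "\<exists>u. ?ivp j u" for j
    by (metis linear_ivp_solvable)
  then obtain u where "\<And>j. ?ivp j (u j)"
    by metis
  from decode_solution[OF \<open>M > 0\<close> \<open>N > 0\<close> \<psi>0 this]
  show "\<exists>\<psi>. solves_diffusion M N \<beta> \<psi>0 \<psi>"
    by blast
next
  fix \<psi>0 \<psi> u r k l and t :: real
  assume \<psi>: "solves_diffusion M N \<beta> \<psi>0 \<psi>"
    and u: "\<forall>j<M^2. solves_linear_ivp N (mode_matrix M N \<beta> j) (encode M (analysis M) \<psi>0 j) (u j)"
    and "t \<ge> 0" "r \<in> {1..int N}"
  have "\<psi> t \<in> periodic_tables M N"
    using \<psi> \<open>t \<ge> 0\<close> by (simp add: solves_diffusion_def)
  then have "\<psi> t r k l = decode M (synthesis M) (encode M (analysis M) (\<psi> t)) r k l"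
    by (simp add: decode_encode[OF \<open>M > 0\<close>])
  also have "\<dots> = decode M (synthesis M) (\<lambda>j. u j t) r k l"
    unfolding decode_def
  proof (intro sum.cong refl arg_cong2[where f = "(*)"])
    fix j assume "j \<in> {..<M^2}"
    then show "encode M (analysis M) (\<psi> t) j r = u j t r"
      using linear_ivp_unique[OF encode_solution[OF \<open>M > 0\<close> \<open>N > 0\<close> \<psi>, of j]] u
        \<open>t \<ge> 0\<close> \<open>r \<in> {1..int N}\<close> by simp
  qed
  finally show "\<psi> t r k l = decode M (synthesis M) (\<lambda>j. u j t) r k l" .
qed

end
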